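(* Let $n\ge 1$ and let $h=(h_1,\ldots,h_n)$ be a Hessenberg function. Then $I_h=J_h$ as ideals of $\mathbb{Z}[x_1,\ldots,x_n]$.
   Context: A Hessenberg function is an $n$-tuple $h=(h_1,\ldots,h_n)$ of integers with $i\le h_i\le n$ for all $i$ and $h_i\le h_{i+1}$ for $1\le i\le n-1$. For $S\subseteq\{1,\ldots,n\}$ and an integer $d$: the truncated elementary symmetric function $e_d(S)$ is the sum of all squarefree monomials $x_{i_1}\cdots x_{i_d}$ with $i_1<\cdots<i_d$ in $S$; the truncated complete symmetric function $\tilde e_d(S)$ is the sum of all monomials $x_{i_1}\cdots x_{i_d}$ with $i_1\le\cdots\le i_d$ in $S$. Conventions: $e_0(S)=\tilde e_0(S)=1$ (also for $S=\emptyset$), both are $0$ for $d<0$, $e_d(S)=0$ for $d>|S|$, and $\tilde e_d(\emptyset)=0$ for $d>0$. We write $e_d(a,\ldots,b)$, $\tilde e_d(a,\ldots,b)$ for $S=\{a,a+1,\ldots,b\}$. The ideal $I_h$ is the ideal of $\mathbb{Z}[x_1,\ldots,x_n]$ generated by $\mathfrak{C}_h=\{e_{h_i-r}(1,\ldots,h_i): 1\le i\le n,\ 0\le r\le i-1\}$. The degree tuple of $h$ is $\beta=(\beta_n,\ldots,\beta_1)$ with $\beta_i=i-\#\{k: h_k<i\}$, and $J_h$ is the ideal generated by $\tilde e_{\beta_i}(i,i+1,\ldots,n)$ for $i=1,\ldots,n$. *)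

theory Defs
  imports "HOL-Library.Poly_Mapping" "HOL-Library.Multiset" "HOL-Algebra.Ideal"
begin

type_synonym int_mpoly = "(nat \<Rightarrow>\<^sub>0 nat) \<Rightarrow>\<^sub>0 int"

definition Var :: "nat \<Rightarrow> int_mpoly" where
  "Var i = Poly_Mapping.single (Poly_Mapping.single i 1) 1"

text \<open>The type \<^typ>\<open>int_mpoly\<close> has infinitely many variables; the ring
  \<open>\<int>[x\<^sub>1, \<dots>, x\<^sub>n]\<close> is its subring of polynomials whose monomials only involve
  the variables with index in \<open>{1..n}\<close>.\<close>

definition int_poly_ring :: "nat \<Rightarrow> int_mpoly ring" where
  "int_poly_ring n =
     \<lparr>carrier = {p. \<forall>m \<in> Poly_Mapping.keys p. Poly_Mapping.keys m \<subseteq> {1..n}},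
      mult = (*), one = 1, zero = 0, add = (+)\<rparr>"

definition hessenberg :: "nat \<Rightarrow> (nat \<Rightarrow> nat) \<Rightarrow> bool" where
  "hessenberg n h \<longleftrightarrow>
     (\<forall>i \<in> {1..n}. i \<le> h i \<and> h i \<le> n) \<and> (\<forall>i. 1 \<le> i \<and> i \<le> n - 1 \<longrightarrow> h i \<le> h (i + 1))"

text \<open>The index sequences \<open>i\<^sub>1 < \<dots> < i\<^sub>d\<close> in \<open>S\<close> correspond to the \<open>d\<close>-element subsets
  of \<open>S\<close>, the sequences \<open>i\<^sub>1 \<le> \<dots> \<le> i\<^sub>d\<close> to the multisets of size \<open>d\<close> over \<open>S\<close>.\<close>

definition elem_sym :: "int \<Rightarrow> nat set \<Rightarrow> int_mpoly" where
  "elem_sym d S = (\<Sum>T \<in> {T. T \<subseteq> S \<and> int (card T) = d}. \<Prod>i\<in>T. Var i)"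

definition complete_sym :: "int \<Rightarrow> nat set \<Rightarrow> int_mpoly" where
  "complete_sym d S =
     (\<Sum>M \<in> {M. set_mset M \<subseteq> S \<and> int (size M) = d}. \<Prod>i\<in>#M. Var i)"

definition gens_C :: "nat \<Rightarrow> (nat \<Rightarrow> nat) \<Rightarrow> int_mpoly set" where
  "gens_C n h =
     {elem_sym (int (h i) - int r) {1..h i} | i r. 1 \<le> i \<and> i \<le> n \<and> 0 \<le> r \<and> r \<le> i - 1}"

definition ideal_I :: "nat \<Rightarrow> (nat \<Rightarrow> nat) \<Rightarrow> int_mpoly set" where
  "ideal_I n h = Idl\<^bsub>int_poly_ring n\<^esub> (gens_C n h)"

definition degree_tuple :: "nat \<Rightarrow> (nat \<Rightarrow> nat) \<Rightarrow> nat \<Rightarrow> int" where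
  "degree_tuple n h i = int i - int (card {k \<in> {1..n}. h k < i})"

definition gens_J :: "nat \<Rightarrow> (nat \<Rightarrow> nat) \<Rightarrow> int_mpoly set" where
  "gens_J n h = {complete_sym (degree_tuple n h i) {i..n} | i. 1 \<le> i \<and> i \<le> n}"

definition ideal_J :: "nat \<Rightarrow> (nat \<Rightarrow> nat) \<Rightarrow> int_mpoly set" where
  "ideal_J n h = Idl\<^bsub>int_poly_ring n\<^esub> (gens_J n h)"

lemma int_poly_ring_simps [simp]:
  "p \<in> carrier (int_poly_ring n) \<longleftrightarrow>
     (\<forall>m \<in> Poly_Mapping.keys p. Poly_Mapping.keys m \<subseteq> {1..n})"
  "p \<otimes>\<^bsub>int_poly_ring n\<^esub> q = p * q" "p \<oplus>\<^bsub>int_poly_ring n\<^esub> q = p + q"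
  "\<one>\<^bsub>int_poly_ring n\<^esub> = 1" "\<zero>\<^bsub>int_poly_ring n\<^esub> = 0"
  by (simp_all add: int_poly_ring_def)

lemma int_poly_ring_add_closed:
  assumes "p \<in> carrier (int_poly_ring n)" "q \<in> carrier (int_poly_ring n)"
  shows "p + q \<in> carrier (int_poly_ring n)"
  using assms Poly_Mapping.keys_add[of p q] by (auto; blast)

lemma int_poly_ring_mult_closed:
  assumes "p \<in> carrier (int_poly_ring n)" "q \<in> carrier (int_poly_ring n)"
  shows "p * q \<in> carrier (int_poly_ring n)"
  unfolding int_poly_ring_simps
proof
  fix m assume "m \<in> Poly_Mapping.keys (p * q)"
  then obtain a b where ab: "m = a + b" "a \<in> Poly_Mapping.keys p" "b \<in> Poly_Mapping.keys q"
    using Poly_Mapping.keys_mult[of p q] by blast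
  have "Poly_Mapping.keys m \<subseteq> Poly_Mapping.keys a \<union> Poly_Mapping.keys b"
    unfolding ab(1) by (rule Poly_Mapping.keys_add)
  then show "Poly_Mapping.keys m \<subseteq> {1..n}"
    using ab(2,3) assms unfolding int_poly_ring_simps by blast
qed

lemma int_poly_ring_cring: "cring (int_poly_ring n)"
proof (rule cringI)
  have "\<exists>y \<in> carrier (int_poly_ring n). y + x = 0" if "x \<in> carrier (int_poly_ring n)" for x
    using that by (intro bexI[of _ "- x"]) (auto simp: in_keys_iff)
  then show "abelian_group (int_poly_ring n)"
    by (intro abelian_groupI)
      (use int_poly_ring_add_closed in \<open>auto simp: add_ac simp del: int_poly_ring_simps(1)\<close>,
       simp)
  show "comm_monoid (int_poly_ring n)"
    by (intro comm_monoidI)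
      (use int_poly_ring_mult_closed in \<open>auto simp: mult_ac simp del: int_poly_ring_simps(1)\<close>,
       simp)
qed (simp add: distrib_right)

lemma int_poly_ring_sum_closed:
  "(\<And>a. a \<in> A \<Longrightarrow> f a \<in> carrier (int_poly_ring n)) \<Longrightarrow> sum f A \<in> carrier (int_poly_ring n)"
  by (induction A rule: infinite_finite_induct)
    (simp, simp, simp add: int_poly_ring_add_closed del: int_poly_ring_simps(1))

lemma Var_closed: "i \<in> {1..n} \<Longrightarrow> Var i \<in> carrier (int_poly_ring n)"
  by (simp add: Var_def)

lemma prod_mset_Var_closed:
  "set_mset M \<subseteq> {1..n} \<Longrightarrow> (\<Prod>i\<in>#M. Var i) \<in> carrier (int_poly_ring n)"
proof (induction M)
  case empty
  show ?case by simp
next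
  case (add x M)
  then show ?case
    using int_poly_ring_mult_closed[OF Var_closed[of x n]] by simp
qed

lemma elem_sym_closed: "S \<subseteq> {1..n} \<Longrightarrow> elem_sym d S \<in> carrier (int_poly_ring n)"
  unfolding elem_sym_def
proof (rule int_poly_ring_sum_closed, goal_cases)
  case (1 T)
  then have "finite T" "T \<subseteq> {1..n}" by (auto intro: finite_subset)
  then have "(\<Prod>i\<in>#mset_set T. Var i) \<in> carrier (int_poly_ring n)"
    by (intro prod_mset_Var_closed) simp
  then show ?case by (simp only: prod_unfold_prod_mset)
qed

lemma complete_sym_closed: "S \<subseteq> {1..n} \<Longrightarrow> complete_sym d S \<in> carrier (int_poly_ring n)"
  unfolding complete_sym_def
  by (rule int_poly_ring_sum_closed, rule prod_mset_Var_closed) auto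

lemma gens_C_closed: "hessenberg n h \<Longrightarrow> gens_C n h \<subseteq> carrier (int_poly_ring n)"
  unfolding gens_C_def hessenberg_def
  by (force simp del: int_poly_ring_simps(1) intro!: elem_sym_closed)

lemma gens_J_closed: "gens_J n h \<subseteq> carrier (int_poly_ring n)"
  unfolding gens_J_def by (auto simp del: int_poly_ring_simps(1) intro!: complete_sym_closed)

lemma finite_multisets_of_size:
  assumes "finite S"
  shows "finite {M. set_mset M \<subseteq> S \<and> int (size M) = d}"
proof (rule finite_subset)
  show "{M. set_mset M \<subseteq> S \<and> int (size M) = d} \<subseteq> mset ` {xs. set xs \<subseteq> S \<and> length xs = nat d}"
  proof
    fix M assume M: "M \<in> {M. set_mset M \<subseteq> S \<and> int (size M) = d}"
    obtain xs where "M = mset xs" by (metis ex_mset)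
    with M show "M \<in> mset ` {xs. set xs \<subseteq> S \<and> length xs = nat d}" by auto
  qed
qed (simp add: finite_lists_length_eq assms)

lemma elem_sym_0: "finite S \<Longrightarrow> elem_sym 0 S = 1"
proof -
  assume "finite S"
  then have "{T. T \<subseteq> S \<and> int (card T) = 0} = {{}}" by (auto dest: finite_subset)
  then show ?thesis by (simp add: elem_sym_def)
qed

lemma complete_sym_0: "complete_sym 0 S = 1"
proof -
  have "{M. set_mset M \<subseteq> S \<and> int (size M) = 0} = {{#}}" by auto
  then show ?thesis by (simp add: complete_sym_def)
qed

lemma elem_sym_neg: "d < 0 \<Longrightarrow> elem_sym d S = 0"
  by (auto simp: elem_sym_def intro: sum.neutral)

lemma complete_sym_neg: "d < 0 \<Longrightarrow> complete_sym d S = 0"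
  by (auto simp: complete_sym_def intro: sum.neutral)

lemma elem_sym_gt_card: "finite S \<Longrightarrow> d > int (card S) \<Longrightarrow> elem_sym d S = 0"
  unfolding elem_sym_def by (rule sum.neutral) (auto dest: card_mono)

lemma complete_sym_empty: "d > 0 \<Longrightarrow> complete_sym d {} = 0"
  unfolding complete_sym_def by (rule sum.neutral) auto

end

theory Submission
  imports Defs
begin

text \<open>Writing \<open>c\<^sub>j\<close> for the complete functions, splitting \<open>{1..n}\<close> at \<open>k\<close> gives
  \<open>e\<^sub>d(1..k) = \<Sum>\<^sub>j (-1)\<^sup>j e\<^sub>d\<^sub>-\<^sub>j(1..n) \<cdot> c\<^sub>j(k+1..n)\<close>.
  Both ideals contain every \<open>e\<^sub>d(1..n)\<close> with \<open>d \<ge> 1\<close> (for the first one because \<open>h\<^sub>n = n\<close>,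
  for the second one because \<open>\<beta>\<^sub>1 = 1\<close>), so modulo either of them \<open>e\<^sub>d(1..k)\<close> agrees up to
  sign with \<open>c\<^sub>d(k+1..n)\<close>. What remains is to move between the complete functions in \<open>i..n\<close>
  and in \<open>i+1..n\<close>, where the minimal degree available grows by at most one.\<close>

declare int_poly_ring_simps(1) [simp del]

section \<open>Recursions in the set of variables and the alternating-sum identity\<close>

lemma elem_sym_insert:
  assumes "finite S" "a \<notin> S"
  shows "elem_sym d (insert a S) = elem_sym d S + Var a * elem_sym (d - 1) S"
proof -
  let ?A = "{T. T \<subseteq> S \<and> int (card T) = d}"
  let ?B = "{T. T \<subseteq> S \<and> int (card T) = d - 1}"
  have fin: "finite ?A" "finite ?B" using assms(1) by auto
  have split: "{T. T \<subseteq> insert a S \<and> int (card T) = d} = ?A \<union> insert a ` ?B" (is "?L = ?R")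
  proof
    show "?L \<subseteq> ?R"
    proof
      fix T assume T: "T \<in> ?L"
      then have "finite T" using assms(1) finite_subset by auto
      show "T \<in> ?R"
      proof (cases "a \<in> T")
        case True
        then have "T = insert a (T - {a})" by auto
        moreover have "T - {a} \<in> ?B"
          using T True \<open>finite T\<close> card_Suc_Diff1[OF \<open>finite T\<close> True] by auto
        ultimately show ?thesis by blast
      qed (use T in auto)
    qed
    show "?R \<subseteq> ?L"
    proof
      fix T assume "T \<in> ?R"
      then show "T \<in> ?L"
      proof
        assume "T \<in> insert a ` ?B"
        then obtain U where U: "U \<in> ?B" "T = insert a U" by blast
        then have "finite U" "a \<notin> U" using assms finite_subset by auto
        with U show ?thesis by auto
      qed auto
    qed
  qed
  have "inj_on (insert a) ?B"
    using assms(2) by (intro inj_onI) (metis (mono_tags, lifting) insert_ident mem_Collect_eq subsetD)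
  then have "(\<Sum>T\<in>insert a ` ?B. \<Prod>i\<in>T. Var i) = (\<Sum>T\<in>?B. \<Prod>i\<in>insert a T. Var i)"
    by (simp add: sum.reindex)
  also have "\<dots> = (\<Sum>T\<in>?B. Var a * (\<Prod>i\<in>T. Var i))"
  proof (rule sum.cong[OF refl])
    fix T assume "T \<in> ?B"
    then have "finite T" "a \<notin> T" using assms finite_subset by auto
    then show "(\<Prod>i\<in>insert a T. Var i) = Var a * (\<Prod>i\<in>T. Var i)" by simp
  qed
  finally have *: "(\<Sum>T\<in>insert a ` ?B. \<Prod>i\<in>T. Var i) = Var a * elem_sym (d - 1) S"
    by (simp add: elem_sym_def sum_distrib_left)
  have "?A \<inter> insert a ` ?B = {}" using assms(2) by auto
  then show ?thesis
    unfolding elem_sym_def[of d "insert a S"] split using fin *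
    by (subst sum.union_disjoint) (auto simp: elem_sym_def)
qed

text \<open>A multiset containing \<open>a\<close> loses one copy of it; since further copies may
  remain, the last factor is still taken over \<open>insert a S\<close>.\<close>

lemma complete_sym_insert:
  assumes "finite S" "a \<notin> S"
  shows "complete_sym d (insert a S) = complete_sym d S + Var a * complete_sym (d - 1) (insert a S)"
proof -
  let ?A = "{M. set_mset M \<subseteq> S \<and> int (size M) = d}"
  let ?B = "{M. set_mset M \<subseteq> insert a S \<and> int (size M) = d - 1}"
  have fin: "finite ?A" "finite ?B" using assms(1) by (auto intro: finite_multisets_of_size)
  have split: "{M. set_mset M \<subseteq> insert a S \<and> int (size M) = d} = ?A \<union> add_mset a ` ?B" (is "?L = ?R")
  proof
    show "?L \<subseteq> ?R"
    proof
      fix M assume M: "M \<in> ?L"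
      show "M \<in> ?R"
      proof (cases "a \<in># M")
        case True
        then obtain N where "M = add_mset a N" by (metis insert_DiffM)
        with M show ?thesis by auto
      qed (use M in auto)
    qed
  qed auto
  have "(\<Sum>M\<in>add_mset a ` ?B. \<Prod>i\<in>#M. Var i) = Var a * complete_sym (d - 1) (insert a S)"
    by (simp add: sum.reindex complete_sym_def sum_distrib_left inj_on_def)
  moreover have "?A \<inter> add_mset a ` ?B = {}"
  proof (rule equals0I)
    fix M assume "M \<in> ?A \<inter> add_mset a ` ?B"
    then obtain N where "set_mset M \<subseteq> S" "M = add_mset a N" by blast
    then show False using assms(2) by simp
  qed
  ultimately show ?thesis
    unfolding complete_sym_def[of d "insert a S"] split using fin
    by (subst sum.union_disjoint) (auto simp: complete_sym_def)
qed

text \<open>Coefficient of t^d in prod_{A} (1 + x t) = prod_{A \<union> B} (1 + x t) / prod_{B} (1 +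
  x t), the reciprocal having coefficients (-1)^j times the complete functions of \<open>B\<close>.
  Induction on \<open>B\<close> avoids power series.\<close>

lemma elem_sym_eq_alternating_sum:
  assumes "finite A" "finite B" "A \<inter> B = {}"
  shows "elem_sym (int d) A =
    (\<Sum>j\<le>d. (-1) ^ j * elem_sym (int d - int j) (A \<union> B) * complete_sym (int j) B)"
  using assms(2,3)
proof (induction B rule: finite_induct)
  case empty
  have "(\<Sum>j\<le>d. (-1) ^ j * elem_sym (int d - int j) (A \<union> {}) * complete_sym (int j) {}) =
    (\<Sum>j\<le>d. if j = 0 then elem_sym (int d) A else 0)"
    by (intro sum.cong) (auto simp: complete_sym_0 complete_sym_empty)
  then show ?case by simp
next
  case (insert a B)
  define E where "E j = elem_sym (int d - int j) (A \<union> B)" for j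
  define H where "H j = complete_sym (int j) (insert a B)" for j
  \<comment> \<open>This is the degree -1 term; it lets the sums below run to \<open>Suc d\<close>
    or stop at \<open>d\<close>, as the index shift demands.\<close>
  have E_last: "E (Suc d) = 0" by (simp add: E_def elem_sym_neg)
  have step: "elem_sym (int d - int j) (A \<union> insert a B) = E j + Var a * E (Suc j)" for j
    using elem_sym_insert[of "A \<union> B" a "int d - int j"] insert assms(1)
    by (simp add: E_def algebra_simps)
  have H_0: "complete_sym (int 0) B = H 0" by (simp add: H_def complete_sym_0)
  have H_Suc: "complete_sym (int (Suc j)) B = H (Suc j) - Var a * H j" for j
    using complete_sym_insert[of B a "int (Suc j)"] insert by (simp add: H_def)
  have "elem_sym (int d) A = (\<Sum>j\<le>d. (-1) ^ j * E j * complete_sym (int j) B)"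
    using insert by (simp add: E_def)
  also have "\<dots> = (\<Sum>j\<le>Suc d. (-1) ^ j * E j * complete_sym (int j) B)"
    by (simp add: E_last)
  also have "\<dots> = E 0 * H 0 + (\<Sum>j\<le>d. (-1) ^ Suc j * E (Suc j) * (H (Suc j) - Var a * H j))"
    by (subst sum.atMost_Suc_shift) (simp only: H_0 H_Suc, simp)
  also have "\<dots> = (E 0 * H 0 + (\<Sum>j\<le>d. (-1) ^ Suc j * E (Suc j) * H (Suc j))) +
      (\<Sum>j\<le>d. (-1) ^ j * (Var a * E (Suc j)) * H j)"
    by (simp add: algebra_simps sum.distrib sum_subtractf sum_negf)
  also have "E 0 * H 0 + (\<Sum>j\<le>d. (-1) ^ Suc j * E (Suc j) * H (Suc j)) =
      (\<Sum>j\<le>Suc d. (-1) ^ j * E j * H j)"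
    by (subst sum.atMost_Suc_shift) simp
  also have "\<dots> = (\<Sum>j\<le>d. (-1) ^ j * E j * H j)" by (simp add: E_last)
  also have "\<dots> + (\<Sum>j\<le>d. (-1) ^ j * (Var a * E (Suc j)) * H j) =
      (\<Sum>j\<le>d. (-1) ^ j * (E j + Var a * E (Suc j)) * H j)"
    by (simp add: algebra_simps sum.distrib)
  finally show ?case by (simp only: step H_def)
qed

section \<open>Membership in an arbitrary ideal of the polynomial ring\<close>

lemma int_poly_ring_uminus_closed:
  "p \<in> carrier (int_poly_ring n) \<Longrightarrow> - p \<in> carrier (int_poly_ring n)"
  by (simp add: int_poly_ring_simps(1) in_keys_iff)

context
  fixes K :: "int_mpoly set" and n :: nat
  assumes K: "ideal K (int_poly_ring n)"
begin

lemma ideal_add_closed: "p \<in> K \<Longrightarrow> q \<in> K \<Longrightarrow> p + q \<in> K"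
  using additive_subgroup.a_closed[OF ideal.axioms(1)[OF K]] by simp

lemma ideal_zero_closed: "0 \<in> K"
  using additive_subgroup.zero_closed[OF ideal.axioms(1)[OF K]] by simp

lemma ideal_mult_closed: "c \<in> carrier (int_poly_ring n) \<Longrightarrow> p \<in> K \<Longrightarrow> c * p \<in> K"
  using ideal.I_l_closed[OF K, of p c] by simp

lemma ideal_uminus_closed: "p \<in> K \<Longrightarrow> - p \<in> K"
  using ideal_mult_closed[OF int_poly_ring_uminus_closed, of 1 p]
  by (simp add: int_poly_ring_simps(1))

lemma ideal_diff_closed: "p \<in> K \<Longrightarrow> q \<in> K \<Longrightarrow> p - q \<in> K"
  using ideal_add_closed[OF _ ideal_uminus_closed, of p q] by simp

lemma ideal_sum_closed: "(\<And>a. a \<in> A \<Longrightarrow> f a \<in> K) \<Longrightarrow> sum f A \<in> K"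
  by (induction A rule: infinite_finite_induct) (auto intro: ideal_zero_closed ideal_add_closed)

lemma ideal_sign_iff: "(-1) ^ j * p \<in> K \<longleftrightarrow> p \<in> K"
  by (cases "even j") (use ideal_uminus_closed[of p] ideal_uminus_closed[of "- p"] in auto)

text \<open>Every summand of the alternating sum with j < d has a factor e_{d-j}(1..n) in
  \<open>K\<close>; the summand j = d is the complete function up to sign.\<close>

lemma elem_sym_mem_iff_complete_sym_mem:
  assumes "\<And>d. d \<ge> 1 \<Longrightarrow> elem_sym (int d) {1..n} \<in> K" and "k \<le> n"
  shows "elem_sym (int d) {1..k} \<in> K \<longleftrightarrow> complete_sym (int d) {Suc k..n} \<in> K"
proof -
  have un: "{1..k} \<union> {Suc k..n} = {1..n}" using assms(2) by auto
  define R where "R = (\<Sum>j<d. (-1) ^ j * elem_sym (int d - int j) {1..n} * complete_sym (int j) {Suc k..n})"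
  have "(-1) ^ j * (complete_sym (int j) {Suc k..n} * elem_sym (int (d - j)) {1..n}) \<in> K" if "j < d" for j
    unfolding ideal_sign_iff using that
    by (intro ideal_mult_closed complete_sym_closed assms(1)) auto
  then have R: "R \<in> K"
    unfolding R_def by (intro ideal_sum_closed) (auto simp: mult_ac)
  have eq: "elem_sym (int d) {1..k} = R + (-1) ^ d * complete_sym (int d) {Suc k..n}"
    using elem_sym_eq_alternating_sum[of "{1..k}" "{Suc k..n}" d]
    unfolding un R_def by (auto simp: elem_sym_0 lessThan_Suc_atMost[symmetric])
  then have eq': "(-1) ^ d * complete_sym (int d) {Suc k..n} = elem_sym (int d) {1..k} - R" by simp
  show ?thesis
    using ideal_add_closed[OF R, of "(-1) ^ d * complete_sym (int d) {Suc k..n}"]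
      ideal_diff_closed[OF _ R, of "elem_sym (int d) {1..k}"] eq eq' ideal_sign_iff by metis
qed

text \<open>With no variables on the left, the identity reads 0 = e_d(1..n) + R, and each summand of
  R contains a complete function of positive degree.\<close>

lemma elem_sym_mem_if_complete_sym_mem:
  assumes "\<And>d. d \<ge> 1 \<Longrightarrow> complete_sym (int d) {1..n} \<in> K" and "d \<ge> 1"
  shows "elem_sym (int d) {1..n} \<in> K"
proof -
  define R where "R = (\<Sum>j<d. (-1) ^ Suc j * elem_sym (int d - int (Suc j)) {1..n} * complete_sym (int (Suc j)) {1..n})"
  have "(-1) ^ Suc j * (elem_sym (int d - int (Suc j)) {1..n} * complete_sym (int (Suc j)) {1..n}) \<in> K" for j
    unfolding ideal_sign_iff by (intro ideal_mult_closed elem_sym_closed assms(1)) auto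
  then have "R \<in> K"
    unfolding R_def by (intro ideal_sum_closed) (simp only: mult.assoc)
  moreover have "elem_sym (int d) {} = 0" using assms(2) by (intro elem_sym_gt_card) auto
  then have "elem_sym (int d) {1..n} + R = 0"
    using elem_sym_eq_alternating_sum[of "{}" "{1..n}" d]
    by (simp add: R_def complete_sym_0 lessThan_Suc_atMost[symmetric] sum.lessThan_Suc_shift
        del: sum.lessThan_Suc)
  then have "elem_sym (int d) {1..n} = - R" by (simp add: eq_neg_iff_add_eq_0)
  ultimately show ?thesis using ideal_uminus_closed by simp
qed

text \<open>The recursion solved for the smaller variable set uses degrees d and d - 1 in
  \<open>{i..n}\<close>, both at least \<open>b\<close>; \<open>d \<ge> 1\<close> keeps the natural
  subtraction exact.\<close>

lemma complete_sym_mem_Suc: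
  assumes "\<And>d. int d \<ge> b \<Longrightarrow> complete_sym (int d) {i..n} \<in> K"
    and "1 \<le> i" "i \<le> n" "int d \<ge> b + 1" "d \<ge> 1"
  shows "complete_sym (int d) {Suc i..n} \<in> K"
proof -
  have "{i..n} = insert i {Suc i..n}" using assms(3) by auto
  then have "complete_sym (int d) {Suc i..n} =
      complete_sym (int d) {i..n} - Var i * complete_sym (int (d - 1)) {i..n}"
    using complete_sym_insert[of "{Suc i..n}" i "int d"] assms(5) by simp
  moreover have "complete_sym (int d) {i..n} \<in> K" using assms(4) by (intro assms(1)) simp
  moreover have "Var i * complete_sym (int (d - 1)) {i..n} \<in> K"
    using assms by (intro ideal_mult_closed Var_closed assms(1)) auto
  ultimately show ?thesis using ideal_diff_closed by simp
qed

lemma complete_sym_mem_shift: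
  assumes "\<And>d. int d \<ge> b \<Longrightarrow> complete_sym (int d) {i..n} \<in> K"
    and "1 \<le> i" "i + m \<le> Suc n" "b \<ge> 0" "int d \<ge> b + int m"
  shows "complete_sym (int d) {i + m..n} \<in> K"
  using assms(3,5)
proof (induction m arbitrary: d)
  case 0
  then show ?case using assms(1) by simp
next
  case (Suc m)
  then show ?case
    using complete_sym_mem_Suc[of "b + int m" "i + m" d] assms(2,4) by simp
qed

end

section \<open>Hessenberg functions and their degree tuples\<close>

lemma degree_tuple_Suc_le: "degree_tuple n h (Suc i) \<le> degree_tuple n h i + 1"
proof -
  have "card {k \<in> {1..n}. h k < i} \<le> card {k \<in> {1..n}. h k < Suc i}" by (intro card_mono) auto
  then show ?thesis by (simp add: degree_tuple_def)
qed

lemma hessenberg_mono: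
  assumes "hessenberg n h" "1 \<le> i" "i \<le> j" "j \<le> n"
  shows "h i \<le> h j"
  using assms(3,4)
proof (induction j rule: dec_induct)
  case (step j)
  then show ?case using assms(1,2) unfolding hessenberg_def
    by (metis Suc_eq_plus1 Suc_leD diff_Suc_1 diff_le_mono le_trans)
qed simp

text \<open>By monotonicity the set is closed downwards. Hence its cardinality, when positive, is
  also its largest element.\<close>

lemma hessenberg_less_eq_atLeastAtMost:
  assumes "hessenberg n h"
  shows "{k \<in> {1..n}. h k < i} = {1..card {k \<in> {1..n}. h k < i}}" (is "?S = _")
proof (cases "?S = {}")
  case False
  let ?m = "Max ?S"
  have fin: "finite ?S" by simp
  have m: "?m \<in> ?S" using Max_in[OF fin False] .
  have "?S = {1..?m}"
  proof
    show "?S \<subseteq> {1..?m}"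
    proof
      fix k assume k: "k \<in> ?S"
      then show "k \<in> {1..?m}" using Max_ge[OF fin k] by simp
    qed
    show "{1..?m} \<subseteq> ?S"
    proof
      fix k assume "k \<in> {1..?m}"
      then show "k \<in> ?S" using m hessenberg_mono[OF assms, of k ?m] by auto
    qed
  qed
  then show ?thesis by (metis card_atLeastAtMost diff_Suc_1)
next
  case True
  then show ?thesis by (metis atLeastatMost_empty card.empty zero_less_one)
qed

text \<open>Since k \<le> \<open>h k\<close>, only indices k < i can be counted.\<close>

lemma degree_tuple_pos:
  assumes "hessenberg n h" "1 \<le> i"
  shows "degree_tuple n h i \<ge> 1"
proof -
  have "{k \<in> {1..n}. h k < i} \<subseteq> {1..<i}" using assms unfolding hessenberg_def by force
  then have "card {k \<in> {1..n}. h k < i} \<le> card {1..<i}" by (intro card_mono) auto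
  then show ?thesis using assms(2) by (simp add: degree_tuple_def)
qed

section \<open>The two inclusions\<close>

text \<open>The generators supply only the degree \<open>degree_tuple n h i\<close> itself. Higher
  degrees follow by descending induction on \<open>i\<close>, and for each \<open>i\<close> by
  induction on \<open>d\<close>, from c_{d+1}(i..n) = c_{d+1}(i+1..n) + x_i c_d(i..n).\<close>

lemma complete_sym_mem_ideal_J:
  assumes "hessenberg n h" "1 \<le> i" "i \<le> Suc n" "int d \<ge> degree_tuple n h i"
  shows "complete_sym (int d) {i..n} \<in> ideal_J n h"
proof -
  interpret cring "int_poly_ring n" by (rule int_poly_ring_cring)
  have J: "ideal (ideal_J n h) (int_poly_ring n)"
    unfolding ideal_J_def by (rule genideal_ideal[OF gens_J_closed])
  have gen: "complete_sym (degree_tuple n h i) {i..n} \<in> ideal_J n h" if "1 \<le> i" "i \<le> n" for i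
    using that genideal_self[OF gens_J_closed] unfolding ideal_J_def gens_J_def by blast
  show ?thesis
    using assms(3,2,4)
  proof (induction i arbitrary: d rule: inc_induct)
    \<comment> \<open>Here \<open>i = Suc n\<close>: no variables are left and the degree is
      positive, so the function is 0.\<close>
    case base
    then have "int d > 0" using degree_tuple_pos[OF assms(1), of "Suc n"] by simp
    then show ?case using ideal_zero_closed[OF J] by (simp add: complete_sym_empty)
  next
    case (step i)
    have ins: "{i..n} = insert i {Suc i..n}" using step.hyps by auto
    have pos: "degree_tuple n h i \<ge> 1" using degree_tuple_pos[OF assms(1)] step.prems by simp
    have "int d \<ge> degree_tuple n h i \<Longrightarrow> complete_sym (int d) {i..n} \<in> ideal_J n h" for d
    proof (induction d)
      case 0
      then show ?case using pos by simp
    next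
      case (Suc d)
      show ?case
      proof (cases "int (Suc d) = degree_tuple n h i")
        case True
        then show ?thesis using gen[of i] step.hyps step.prems by simp
      next
        case False
        then have d: "int d \<ge> degree_tuple n h i" using Suc.prems by simp
        \<comment> \<open>The degree tuple rises by at most one from \<open>i\<close> to
          \<open>Suc i\<close>, so degree \<open>Suc d\<close> is covered by the outer
          hypothesis.\<close>
        have "complete_sym (int (Suc d)) {Suc i..n} \<in> ideal_J n h"
          using step.IH[of "Suc d"] d degree_tuple_Suc_le[of n h i] by simp
        moreover have "Var i * complete_sym (int d) {i..n} \<in> ideal_J n h"
          using step.hyps step.prems d by (intro ideal_mult_closed[OF J] Var_closed Suc.IH) auto
        ultimately show ?thesis
          using ideal_add_closed[OF J] complete_sym_insert[of "{Suc i..n}" i "int (Suc d)"]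
          by (simp add: ins)
      qed
    qed
    then show ?case using step.prems by simp
  qed
qed

lemma ideal_I_subset_ideal_J:
  assumes "hessenberg n h"
  shows "ideal_I n h \<subseteq> ideal_J n h"
proof -
  interpret cring "int_poly_ring n" by (rule int_poly_ring_cring)
  have J: "ideal (ideal_J n h) (int_poly_ring n)"
    unfolding ideal_J_def by (rule genideal_ideal[OF gens_J_closed])
  have "degree_tuple n h 1 \<le> 1" by (simp add: degree_tuple_def)
  then have "complete_sym (int d) {1..n} \<in> ideal_J n h" if "d \<ge> 1" for d
    using that by (intro complete_sym_mem_ideal_J[OF assms]) auto
  then have E: "elem_sym (int d) {1..n} \<in> ideal_J n h" if "d \<ge> 1" for d
    using elem_sym_mem_if_complete_sym_mem[OF J] that by blast
  have "elem_sym (int (h i) - int r) {1..h i} \<in> ideal_J n h"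
    if i: "1 \<le> i" "i \<le> n" and r: "r \<le> i - 1" for i r
  proof -
    have hi: "i \<le> h i" "h i \<le> n" using assms i unfolding hessenberg_def by auto
    \<comment> \<open>At least \<open>i\<close> values of \<open>h\<close> are at most
      \<open>h i\<close>, so the degree required at \<open>Suc (h i)\<close> is at most h_i + 1 - i,
      hence at most h_i - r.\<close>
    have "{1..i} \<subseteq> {k \<in> {1..n}. h k < Suc (h i)}"
      using hessenberg_mono[OF assms] i by (auto simp: less_Suc_eq_le)
    then have "card {1..i} \<le> card {k \<in> {1..n}. h k < Suc (h i)}" by (intro card_mono) auto
    then have "degree_tuple n h (Suc (h i)) \<le> int (h i - r)"
      using hi r i by (simp add: degree_tuple_def)
    then have "complete_sym (int (h i - r)) {Suc (h i)..n} \<in> ideal_J n h"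
      using hi by (intro complete_sym_mem_ideal_J[OF assms]) auto
    then have "elem_sym (int (h i - r)) {1..h i} \<in> ideal_J n h"
      using elem_sym_mem_iff_complete_sym_mem[OF J E] hi by blast
    then show ?thesis using hi r by simp
  qed
  then have "gens_C n h \<subseteq> ideal_J n h" unfolding gens_C_def by blast
  then show ?thesis unfolding ideal_I_def by (rule genideal_minimal[OF J])
qed

lemma ideal_J_subset_ideal_I:
  assumes "n \<ge> 1" "hessenberg n h"
  shows "ideal_J n h \<subseteq> ideal_I n h"
proof -
  interpret cring "int_poly_ring n" by (rule int_poly_ring_cring)
  have I: "ideal (ideal_I n h) (int_poly_ring n)"
    unfolding ideal_I_def by (rule genideal_ideal[OF gens_C_closed[OF assms(2)]])
  have gen: "elem_sym (int (h i) - int r) {1..h i} \<in> ideal_I n h" if "1 \<le> i" "i \<le> n" "r \<le> i - 1" for i r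
    using that genideal_self[OF gens_C_closed[OF assms(2)]] unfolding ideal_I_def gens_C_def by blast
  have big: "elem_sym (int d) {1..k} \<in> ideal_I n h" if "d > k" for d k
    using that ideal_zero_closed[OF I] by (simp add: elem_sym_gt_card)
  have hn: "h n = n" using assms unfolding hessenberg_def by force
  \<comment> \<open>The generators with index \<open>n\<close> are exactly e_1, ..., e_n in all
    variables; higher degrees vanish.\<close>
  have E: "elem_sym (int d) {1..n} \<in> ideal_I n h" if "d \<ge> 1" for d
  proof (cases "d \<le> n")
    case True
    then show ?thesis using gen[of n "n - d"] that assms(1) by (simp add: hn)
  qed (use big in simp)
  have "complete_sym (degree_tuple n h i) {i..n} \<in> ideal_I n h" if i: "1 \<le> i" "i \<le> n" for i
  proof -
    define c where "c = card {k \<in> {1..n}. h k < i}"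
    \<comment> \<open>\<open>k\<close> is the largest value of \<open>h\<close> below \<open>i\<close>, or \<open>0\<close> if there is none.\<close>
    define k where "k = (if c = 0 then 0 else h c)"
    \<comment> \<open>The set is the initial segment \<open>{1..c}\<close>, so \<open>c\<close> is
      its largest index.\<close>
    have "c \<in> {k \<in> {1..n}. h k < i}" if "c > 0"
      by (subst hessenberg_less_eq_atLeastAtMost[OF assms(2)]) (use that in \<open>simp add: c_def\<close>)
    then have c: "c > 0 \<Longrightarrow> 1 \<le> c \<and> c \<le> n \<and> h c < i" by auto
    then have k: "c \<le> k" "k < i" using i assms(2) by (auto simp: k_def hessenberg_def)
    \<comment> \<open>The generators with index \<open>c\<close> cover the degrees k - c + 1 to k,
      and larger degrees vanish. If \<open>c = 0\<close>, then \<open>k = 0\<close> and only the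
      vanishing case occurs.\<close>
    have "elem_sym (int d) {1..k} \<in> ideal_I n h" if d: "int d \<ge> int k - int c + 1" for d
    proof (cases "d > k")
      case False
      then have "c > 0" using d k_def by (cases "c = 0") auto
      moreover have "k - d \<le> c - 1" using d False k by linarith
      ultimately show ?thesis using gen[of c "k - d"] c False by (simp add: k_def)
    qed (rule big)
    then have "complete_sym (int d) {Suc k..n} \<in> ideal_I n h" if "int d \<ge> int k - int c + 1" for d
      using elem_sym_mem_iff_complete_sym_mem[OF I E] that k i by simp
    \<comment> \<open>Going from k + 1 to i raises the bound k - c + 1 by i - k - 1, which gives
      exactly i - c, the entry of the degree tuple at \<open>i\<close>.\<close>
    then have "complete_sym (int (i - c)) {Suc k + (i - Suc k)..n} \<in> ideal_I n h"
      using k i by (intro complete_sym_mem_shift[OF I, of "int k - int c + 1"]) auto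
    then show ?thesis using k unfolding degree_tuple_def c_def[symmetric] by simp
  qed
  then have "gens_J n h \<subseteq> ideal_I n h" unfolding gens_J_def by blast
  then show ?thesis unfolding ideal_J_def by (rule genideal_minimal[OF I])
qed

theorem theorem6p9:
  fixes n :: nat and h :: "nat \<Rightarrow> nat"
  assumes "n \<ge> 1" and "hessenberg n h"
  shows "ideal_I n h = ideal_J n h"
  using ideal_I_subset_ideal_J[OF assms(2)] ideal_J_subset_ideal_I[OF assms] by blast

end
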